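(* The $\mathcal{G}$-invariant of a matroid is determined by its catenary data and conversely (that is, for two matroids $M,M'$ of rank $r$ on $n$ elements, $\mathcal{G}(M)=\mathcal{G}(M')$ if and only if $M$ and $M'$ have the same catenary data). In particular, for every rank-$r$ matroid $M$ on a set of $n$ elements, $$\mathcal{G}(M)=\sum_{(a_0,a_1,\ldots,a_r)}\nu(M;a_0,a_1,\ldots,a_r)\,\gamma(a_0,a_1,\ldots,a_r),$$ where the sum is over all $(n,r)$-compositions $(a_0,a_1,\ldots,a_r)$.
   Context: Matroids are on finite sets. An $(n,r)$-sequence is a $0,1$-sequence of length $n$ with exactly $r$ ones. $\mathcal{G}(n,r)$ is the vector space over a field of characteristic zero with basis the formal symbols $[\underline{r}]$, one for each $(n,r)$-sequence $\underline{r}$. For a rank-$r$ matroid $M$ with rank function $r(\cdot)$ on an $n$-element set $E$, and a permutation (linear ordering) $\pi=(\pi(1),\ldots,\pi(n))$ of $E$, the rank sequence $\underline{r}(\pi)=r_1r_2\ldots r_n$ is given by $r_1=r(\{\pi(1)\})$ and $r_j=r(\{\pi(1),\ldots,\pi(j)\})-r(\{\pi(1),\ldots,\pi(j-1)\})$ for $j\ge2$. The $\mathcal{G}$-invariant is $\mathcal{G}(M)=\sum_{\pi}[\underline{r}(\pi)]\in\mathcal{G}(n,r)$, the sum over all $n!$ permutations of $E$. An $(n,r)$-composition is an integer sequence $(a_0,a_1,\ldots,a_r)$ with $a_0\ge0$, $a_j>0$ for $1\le j\le r$, and $a_0+\cdots+a_r=n$. A flag of $M$ is a chain $X_0\subset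 X_1\subset\cdots\subset X_r=E$ of flats with $r(X_j)=j$ (so $X_0=\mathrm{cl}(\emptyset)$); its composition is $(|X_0|,|X_1-X_0|,\ldots,|X_r-X_{r-1}|)$. $\nu(M;a_0,\ldots,a_r)$ is the number of flags of $M$ with composition $(a_0,\ldots,a_r)$, and the catenary data of $M$ is the vector $(\nu(M;a_0,\ldots,a_r))$ indexed by $(n,r)$-compositions. Write $(b_0,\ldots,b_r)\trianglerighteq(a_0,\ldots,a_r)$ if $b_0+\cdots+b_j\le a_0+\cdots+a_j$ for all $j$, and let $(t)_k=t(t-1)\cdots(t-k+1)$. For an $(n,r)$-composition $(a_0,\ldots,a_r)$, $$\gamma(a_0,\ldots,a_r)=\sum_{(b_j)\trianglerighteq(a_j)}(a_0)_{b_0}\Biggl(\prod_{j=1}^r a_j\Bigl(a_j-1+\sum_{i=0}^{j-1}(a_i-b_i)\Bigr)_{b_j-1}\Biggr)[0^{b_0}10^{b_1-1}10^{b_2-1}\ldots10^{b_r-1}],$$ the sum over all $(n,r)$-compositions $(b_0,\ldots,b_r)\trianglerighteq(a_0,\ldots,a_r)$; here $0^{b}$ denotes $b$ consecutive $0$'s. *)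

theory Defs
  imports Complex_Main "HOL-Library.Poly_Mapping" "HOL-Library.FuncSet"
    "HOL-Combinatorics.Multiset_Permutations"
begin

record 'a indep_system =
  ground :: "'a set"
  indep :: "'a set \<Rightarrow> bool"

locale matroid =
  fixes M :: "'a indep_system"
  assumes finite_ground: "finite (ground M)"
    and indep_subset_ground: "indep M I \<Longrightarrow> I \<subseteq> ground M"
    and indep_empty: "indep M {}"
    and indep_subset: "indep M J \<Longrightarrow> I \<subseteq> J \<Longrightarrow> indep M I"
    and indep_augment: "indep M I \<Longrightarrow> indep M J \<Longrightarrow> card I < card J \<Longrightarrow>
      \<exists>x \<in> J - I. indep M (insert x I)"

definition mrank :: "'a indep_system \<Rightarrow> 'a set \<Rightarrow> nat" where
  "mrank M X = Max (card ` {I. I \<subseteq> X \<and> indep M I})"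

definition mclosure :: "'a indep_system \<Rightarrow> 'a set \<Rightarrow> 'a set" where
  "mclosure M X = {x \<in> ground M. mrank M (insert x X) = mrank M X}"

definition mflat :: "'a indep_system \<Rightarrow> 'a set \<Rightarrow> bool" where
  "mflat M X \<longleftrightarrow> X \<subseteq> ground M \<and> mclosure M X = X"

definition nr_sequences :: "nat \<Rightarrow> nat \<Rightarrow> nat list set" where
  "nr_sequences n r = {s. length s = n \<and> set s \<subseteq> {0, 1} \<and> count_list s 1 = r}"

text \<open>
  The free vector space on \<^emph>\<open>all\<close> lists of naturals over a field \<open>'k\<close> is
  \<open>nat list \<Rightarrow>\<^sub>0 'k\<close>, with basis symbols \<open>[s]\<close> given by \<open>Poly_Mapping.single s 1\<close>.
  The space \<open>\<G>(n,r)\<close> is the subspace spanned by the \<open>(n,r)\<close>-sequences.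
\<close>

definition G_space :: "nat \<Rightarrow> nat \<Rightarrow> (nat list \<Rightarrow>\<^sub>0 'k::field_char_0) set" where
  "G_space n r = {x. Poly_Mapping.keys x \<subseteq> nr_sequences n r}"

definition vscale :: "'k::field_char_0 \<Rightarrow> ('b \<Rightarrow>\<^sub>0 'k) \<Rightarrow> ('b \<Rightarrow>\<^sub>0 'k)" where
  "vscale c x = Poly_Mapping.map (\<lambda>t. c * t) x"

text \<open>
  Positions are counted from \<open>0\<close>. The first entry is \<open>r({\<pi>(1)}) - r({}) = r({\<pi>(1)})\<close>.
  By monotonicity of the rank the subtraction on \<open>nat\<close> never truncates.
\<close>

definition rank_sequence :: "'a indep_system \<Rightarrow> 'a list \<Rightarrow> nat list" where
  "rank_sequence M p =
     map (\<lambda>j. mrank M (set (take (Suc j) p)) - mrank M (set (take j p))) [0..<length p]"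

definition G_invariant :: "'a indep_system \<Rightarrow> (nat list \<Rightarrow>\<^sub>0 'k::field_char_0)" where
  "G_invariant M =
     (\<Sum>p\<in>permutations_of_set (ground M). Poly_Mapping.single (rank_sequence M p) 1)"

definition nr_compositions :: "nat \<Rightarrow> nat \<Rightarrow> nat list set" where
  "nr_compositions n r =
     {a. length a = Suc r \<and> (\<forall>j\<in>{1..r}. a ! j > 0) \<and> (\<Sum>j\<le>r. a ! j) = n}"

definition mflag :: "'a indep_system \<Rightarrow> 'a set list \<Rightarrow> bool" where
  "mflag M Xs \<longleftrightarrow> (let r = mrank M (ground M) in
     length Xs = Suc r \<and>
     (\<forall>j\<le>r. mflat M (Xs ! j) \<and> mrank M (Xs ! j) = j) \<and>
     (\<forall>j<r. Xs ! j \<subset> Xs ! Suc j) \<and>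
     Xs ! r = ground M)"

definition flag_composition :: "'a set list \<Rightarrow> nat list" where
  "flag_composition Xs =
     card (Xs ! 0) # map (\<lambda>j. card (Xs ! j - Xs ! (j - 1))) [1..<length Xs]"

definition nu :: "'a indep_system \<Rightarrow> nat list \<Rightarrow> nat" where
  "nu M a = card {Xs. mflag M Xs \<and> flag_composition Xs = a}"

definition catenary_data :: "'a indep_system \<Rightarrow> nat list \<Rightarrow> nat" where
  "catenary_data M =
     restrict (nu M) (nr_compositions (card (ground M)) (mrank M (ground M)))"

definition dominates :: "nat list \<Rightarrow> nat list \<Rightarrow> bool" where
  "dominates b a \<longleftrightarrow> length b = length a \<and>
     (\<forall>j<length a. (\<Sum>i\<le>j. b ! i) \<le> (\<Sum>i\<le>j. a ! i))"

definition falling_fact :: "int \<Rightarrow> nat \<Rightarrow> int" where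
  "falling_fact t k = (\<Prod>i<k. t - int i)"

definition composition_word :: "nat list \<Rightarrow> nat list" where
  "composition_word b =
     replicate (b ! 0) 0 @ concat (map (\<lambda>j. 1 # replicate (b ! j - 1) 0) [1..<length b])"

text \<open>
  The coefficient is computed in \<open>int\<close> because single differences \<open>a\<^sub>i - b\<^sub>i\<close> may be negative.
\<close>

definition gamma_coeff :: "nat list \<Rightarrow> nat list \<Rightarrow> int" where
  "gamma_coeff a b =
     falling_fact (int (a ! 0)) (b ! 0) *
     (\<Prod>j=1..<length a. int (a ! j) *
        falling_fact (int (a ! j) - 1 + (\<Sum>i<j. int (a ! i) - int (b ! i))) (b ! j - 1))"

definition gamma :: "nat \<Rightarrow> nat \<Rightarrow> nat list \<Rightarrow> (nat list \<Rightarrow>\<^sub>0 'k::field_char_0)" where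
  "gamma n r a =
     (\<Sum>b\<in>{b \<in> nr_compositions n r. dominates b a}.
        vscale (of_int (gamma_coeff a b)) (Poly_Mapping.single (composition_word b) 1))"

lemma composition_word_in_nr_sequences:
  assumes "b \<in> nr_compositions n r"
  shows "composition_word b \<in> nr_sequences n r"
proof -
  define w where "w m =
      replicate (b ! 0) (0::nat) @ concat (map (\<lambda>j. 1 # replicate (b ! j - 1) 0) [1..<Suc m])"
    for m :: nat
  have "length (w m) = (\<Sum>j\<le>m. b ! j) \<and> set (w m) \<subseteq> {0, 1} \<and> count_list (w m) (1::nat) = m"
    if "m \<le> r" for m
    using that
  proof (induction m)
    case 0
    then show ?case by (auto simp: w_def count_list_0_iff)
  next
    case (Suc m)
    have "b ! Suc m > 0"
      using assms Suc.prems by (auto simp: nr_compositions_def)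
    moreover have "count_list (replicate k 0) (1::nat) = 0" for k
      by (simp add: count_list_0_iff)
    moreover have "w (Suc m) = w m @ 1 # replicate (b ! Suc m - 1) 0"
      by (simp add: w_def)
    ultimately show ?case using Suc by auto
  qed
  from this[of r] have "w r \<in> nr_sequences n r"
    using assms by (simp add: nr_sequences_def nr_compositions_def)
  moreover have "composition_word b = w r"
    using assms unfolding w_def composition_word_def by (simp only: nr_compositions_def mem_Collect_eq)
  ultimately show ?thesis by simp
qed

lemma gamma_in_G_space: "gamma n r a \<in> G_space n r"
proof -
  have "Poly_Mapping.keys (vscale c (Poly_Mapping.single w 1)) \<subseteq> {w}"
    for c :: "'k::field_char_0" and w :: "nat list"
    by (auto simp: vscale_def in_keys_iff map.rep_eq lookup_single when_def split: if_splits)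
  then show ?thesis
    unfolding gamma_def G_space_def
    using composition_word_in_nr_sequences by (fastforce dest!: subsetD[OF keys_sum])
qed

context matroid
begin

lemma finite_indeps: "finite {I. I \<subseteq> X \<and> indep M I}"
  by (rule finite_subset[of _ "Pow (ground M)"])
    (auto simp: finite_ground dest: indep_subset_ground)

lemma card_le_mrank: "I \<subseteq> X \<Longrightarrow> indep M I \<Longrightarrow> card I \<le> mrank M X"
  unfolding mrank_def using finite_indeps by (intro Max_ge) auto

lemma mrank_le: "(\<And>I. I \<subseteq> X \<Longrightarrow> indep M I \<Longrightarrow> card I \<le> k) \<Longrightarrow> mrank M X \<le> k"
  unfolding mrank_def using finite_indeps indep_empty by (subst Max_le_iff) auto

lemma mrank_empty [simp]: "mrank M {} = 0"
  using mrank_le[of "{}" 0] by auto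

lemma mrank_mono: "X \<subseteq> Y \<Longrightarrow> mrank M X \<le> mrank M Y"
  by (rule mrank_le) (auto intro: card_le_mrank)

lemma mrank_insert_le: "mrank M (insert x X) \<le> Suc (mrank M X)"
proof (rule mrank_le)
  fix I assume I: "I \<subseteq> insert x X" "indep M I"
  have "finite I"
    using I(2) indep_subset_ground finite_ground finite_subset by blast
  have "card (I - {x}) \<le> mrank M X"
    using I by (intro card_le_mrank) (auto intro: indep_subset)
  moreover have "card I \<le> Suc (card (I - {x}))"
    using \<open>finite I\<close> by (auto simp: card_Diff_singleton_if)
  ultimately show "card I \<le> Suc (mrank M X)" by simp
qed

lemma rank_sequence_in_nr_sequences:
  assumes p: "p \<in> permutations_of_set (ground M)"
  shows "rank_sequence M p \<in> nr_sequences (card (ground M)) (mrank M (ground M))"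
proof -
  have len: "length p = card (ground M)" and setp: "set p = ground M"
    using p distinct_card[of p] by (auto simp: permutations_of_set_def)
  define f where "f j = mrank M (set (take j p))" for j
  have rs: "rank_sequence M p = map (\<lambda>j. f (Suc j) - f j) [0..<length p]"
    by (simp add: rank_sequence_def f_def)
  have mono: "f j \<le> f (Suc j)" for j
    unfolding f_def by (intro mrank_mono set_take_subset_set_take) simp
  have step: "f (Suc j) \<le> Suc (f j)" if "j < length p" for j
    using that mrank_insert_le[of "p ! j" "set (take j p)"]
    by (simp add: f_def take_Suc_conv_app_nth)
  have "count_list (map (\<lambda>j. f (Suc j) - f j) [0..<m]) 1 = f m" if "m \<le> length p" for m
    using that
  proof (induction m)
    case 0
    then show ?case by (simp add: f_def)
  next
    case (Suc m)
    then show ?case using mono[of m] step[of m] by auto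
  qed
  from this[of "length p"] have "count_list (rank_sequence M p) 1 = mrank M (ground M)"
    by (simp add: rs f_def setp)
  moreover have "set (rank_sequence M p) \<subseteq> {0, 1}"
    using step by (fastforce simp: rs)
  ultimately show ?thesis by (simp add: nr_sequences_def len rank_sequence_def)
qed

lemma G_invariant_in_G_space:
  "G_invariant M \<in> G_space (card (ground M)) (mrank M (ground M))"
  unfolding G_invariant_def G_space_def
  using rank_sequence_in_nr_sequences by (auto dest!: subsetD[OF keys_sum] split: if_splits)

end

end

theory Submission
  imports Defs
begin

text \<open>
  The closures of the initial segments of a permutation form a flag, so the permutations with
  rank sequence \<open>w\<close> are partitioned by flags. For a fixed flag with composition \<open>a\<close>, building the
  permutation letter by letter shows that the number of permutations with rank sequence
  \<open>composition_word b\<close> is \<open>gamma_coeff a b\<close>: a letter \<open>1\<close> leading from \<open>X\<^sub>k\<close> to \<open>X\<^sub>k\<^sub>+\<^sub>1\<close> can be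
  filled in \<open>|X\<^sub>k\<^sub>+\<^sub>1 - X\<^sub>k|\<close> ways, a letter \<open>0\<close> by any unused element of the current flat. This gives
  the formula for the \<open>\<G>\<close>-invariant. Conversely, the matrix \<open>gamma_coeff\<close> is triangular with respect
  to dominance and has a nonzero diagonal, so the catenary data can be recovered.
\<close>

section \<open>Rank and closure\<close>

context matroid
begin

lemma ex_basis: "\<exists>I\<subseteq>X. indep M I \<and> card I = mrank M X"
proof -
  have "mrank M X \<in> card ` {I. I \<subseteq> X \<and> indep M I}"
    unfolding mrank_def using finite_indeps indep_empty by (intro Max_in) auto
  then show ?thesis by auto
qed

lemma finite_indep: "indep M I \<Longrightarrow> finite I"
  using indep_subset_ground finite_ground finite_subset by blast

text \<open>Augment repeatedly from a maximum independent subset of \<open>X\<close>; the induction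
  is on the number of elements still missing.\<close>

lemma indep_extend:
  assumes "indep M I" "I \<subseteq> X"
  shows "\<exists>J. I \<subseteq> J \<and> J \<subseteq> X \<and> indep M J \<and> card J = mrank M X"
  using assms
proof (induction "mrank M X - card I" arbitrary: I)
  case 0
  then show ?case using card_le_mrank[of I X] by auto
next
  case (Suc k)
  obtain B where B: "B \<subseteq> X" "indep M B" "card B = mrank M X"
    using ex_basis by blast
  moreover have "card I < card B" using B(3) Suc.hyps(2) by linarith
  ultimately obtain x where x: "x \<in> B - I" "indep M (insert x I)"
    using indep_augment[OF Suc.prems(1)] by blast
  have "k = mrank M X - card (insert x I)"
    using x Suc.hyps(2) finite_indep[OF Suc.prems(1)] by simp
  from Suc.hyps(1)[OF this x(2)] show ?case
    using x B(1) Suc.prems(2) by blast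
qed

text \<open>This is the form of submodularity used below. If \<open>x\<close> raised the rank of
  \<open>F\<close>, extend a basis \<open>I\<close> of \<open>A\<close> to a basis \<open>J\<close>
  of \<open>F\<close> and augment \<open>J\<close> inside \<open>insert x F\<close>. Maximality of
  \<open>J\<close> in \<open>F\<close> forces the new element to be \<open>x\<close>, so
  \<open>insert x I\<close> is independent and \<open>x\<close> raises the rank of \<open>A\<close>
  as well.\<close>

lemma mrank_insert_eq_mono:
  assumes "A \<subseteq> F" "mrank M (insert x A) = mrank M A"
  shows "mrank M (insert x F) = mrank M F"
proof (rule ccontr)
  assume "mrank M (insert x F) \<noteq> mrank M F"
  then have gt: "mrank M F < mrank M (insert x F)"
    using mrank_mono[OF subset_insertI[of F x]] by simp
  obtain I where I: "I \<subseteq> A" "indep M I" "card I = mrank M A"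
    using ex_basis by blast
  obtain J where J: "I \<subseteq> J" "J \<subseteq> F" "indep M J" "card J = mrank M F"
    using indep_extend[OF I(2) order_trans[OF I(1) assms(1)]] by blast
  obtain K where K: "K \<subseteq> insert x F" "indep M K" "card K = mrank M (insert x F)"
    using ex_basis by blast
  obtain y where y: "y \<in> K - J" "indep M (insert y J)"
    using indep_augment[OF J(3) K(2)] J(4) K(3) gt by auto
  have "y \<notin> F"
  proof
    assume "y \<in> F"
    then have "card (insert y J) \<le> mrank M F"
      using J y by (intro card_le_mrank) auto
    then show False using y J finite_indep[OF J(3)] by simp
  qed
  then have "y = x" and "x \<notin> I" using y K(1) I(1) assms(1) by auto
  have "indep M (insert x I)"
    using indep_subset[OF y(2), of "insert x I"] \<open>y = x\<close> J(1) by auto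
  then have "card (insert x I) \<le> mrank M (insert x A)"
    using I by (intro card_le_mrank) auto
  then show False
    using assms(2) I \<open>x \<notin> I\<close> finite_indep[OF I(2)] by simp
qed

lemma mclosure_subset_ground: "mclosure M A \<subseteq> ground M"
  by (auto simp: mclosure_def)

lemma subset_mclosure: "A \<subseteq> ground M \<Longrightarrow> A \<subseteq> mclosure M A"
  by (auto simp: mclosure_def insert_absorb)

lemma mclosure_eqI:
  assumes "A \<subseteq> B" "mrank M A = mrank M B"
  shows "mclosure M A = mclosure M B"
proof -
  have "mrank M (insert x A) = mrank M A"
    if "mrank M (insert x B) = mrank M B" for x
    using that assms mrank_mono[OF insert_mono[OF assms(1), of x]]
      mrank_mono[OF subset_insertI[of A x]] by simp
  then show ?thesis
    using mrank_insert_eq_mono[OF assms(1)] by (auto simp: mclosure_def)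
qed

text \<open>Add the elements of the closure one at a time: each leaves the rank of \<open>A\<close>
  unchanged, hence also that of the larger set built so far.\<close>

lemma mrank_mclosure:
  assumes "A \<subseteq> ground M"
  shows "mrank M (mclosure M A) = mrank M A"
proof -
  have "mrank M (S \<union> A) = mrank M A" if "finite S" "S \<subseteq> mclosure M A" for S
    using that
  proof (induction S)
    case (insert x S)
    then have "mrank M (insert x A) = mrank M A" by (auto simp: mclosure_def)
    then have "mrank M (insert x (S \<union> A)) = mrank M (S \<union> A)"
      by (intro mrank_insert_eq_mono[OF Un_upper2])
    then show ?case using insert by simp
  qed simp
  from this[of "mclosure M A"] show ?thesis
    using finite_subset[OF mclosure_subset_ground finite_ground] subset_mclosure[OF assms]
    by (simp add: Un_absorb2)
qed

lemma mflat_mclosure: "A \<subseteq> ground M \<Longrightarrow> mflat M (mclosure M A)"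
  using mclosure_eqI[OF subset_mclosure[of A]]
  by (simp add: mflat_def mclosure_subset_ground mrank_mclosure)

text \<open>A flat is recovered from any spanning subset. This is how an initial segment of a
  permutation determines a member of the flag.\<close>

lemma mflat_eq_mclosure:
  "mflat M F \<Longrightarrow> A \<subseteq> F \<Longrightarrow> mrank M A = mrank M F \<Longrightarrow> F = mclosure M A"
  using mclosure_eqI[of A F] by (simp add: mflat_def)

lemma mclosure_mono: "A \<subseteq> B \<Longrightarrow> mclosure M A \<subseteq> mclosure M B"
  using mrank_insert_eq_mono by (auto simp: mclosure_def)

end

section \<open>Lists adapted to a chain of sets\<close>

text \<open>
  If \<open>X\<close> is a flag and \<open>w\<close> an \<open>(n,r)\<close>-sequence, the adapted lists are exactly the permutations
  whose rank sequence is \<open>w\<close> and whose initial segments have the members of \<open>X\<close> as closures.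
\<close>

definition adapted :: "(nat \<Rightarrow> 'a set) \<Rightarrow> nat list \<Rightarrow> 'a list \<Rightarrow> bool" where
  "adapted X w p \<longleftrightarrow> length p = length w \<and> distinct p \<and>
     (\<forall>i<length w. p ! i \<in> X (count_list (take (Suc i) w) 1) \<and>
        (w ! i = 1 \<longrightarrow> p ! i \<notin> X (count_list (take i w) 1)))"

lemma adapted_Nil [simp]: "adapted X [] p \<longleftrightarrow> p = []"
  by (auto simp: adapted_def)

lemma adapted_snoc [simp]:
  "adapted X (w @ [t]) (p @ [x]) \<longleftrightarrow> adapted X w p \<and> x \<notin> set p \<and>
     x \<in> X (count_list (w @ [t]) 1) \<and> (t = 1 \<longrightarrow> x \<notin> X (count_list w 1))"
  by (auto simp: adapted_def less_Suc_eq nth_append all_conj_distrib)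

lemma adapted_snocE:
  assumes "adapted X (w @ [t]) p"
  obtains q x where "p = q @ [x]"
  using assms by (cases p rule: rev_cases) (auto simp: adapted_def)

text \<open>Splits off the last letter, so that adapted lists can be counted by choosing the prefix
  first and the last element afterwards.\<close>

lemma bij_betw_adapted_snoc:
  "bij_betw (\<lambda>(q, x). q @ [x])
     (SIGMA q:{q. adapted X w q}. {x \<in> X (count_list (w @ [t]) 1).
        x \<notin> set q \<and> (t = 1 \<longrightarrow> x \<notin> X (count_list w 1))})
     {p. adapted X (w @ [t]) p}" (is "bij_betw ?f ?A ?B")
proof (rule bij_betw_imageI)
  show "inj_on ?f ?A" by (auto simp: inj_on_def)
  have "p \<in> ?f ` ?A" if p: "adapted X (w @ [t]) p" for p
  proof -
    obtain q x where "p = q @ [x]" using p by (rule adapted_snocE)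
    then show ?thesis using p by (intro image_eqI[of _ _ "(q, x)"]) simp_all
  qed
  moreover have "?f ` ?A \<subseteq> ?B" by auto
  ultimately show "?f ` ?A = ?B" by blast
qed

text \<open>The subsets \<open>X 0 \<subseteq> \<dots> \<subseteq> X r\<close> stand for a flag; the values of \<open>X\<close> beyond \<open>r\<close> are junk.\<close>

locale set_chain =
  fixes X :: "nat \<Rightarrow> 'a set" and r :: nat
  assumes finite_chain: "j \<le> r \<Longrightarrow> finite (X j)"
    and chain_mono: "i \<le> j \<Longrightarrow> j \<le> r \<Longrightarrow> X i \<subseteq> X j"
begin

lemma set_subset_if_adapted:
  assumes "adapted X w p" "count_list w 1 \<le> r"
  shows "set p \<subseteq> X (count_list w 1)"
  using assms
proof (induction w arbitrary: p rule: rev_induct)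
  case (snoc t w)
  from snoc.prems(1) obtain q x where p: "p = q @ [x]" by (rule adapted_snocE)
  have "set q \<subseteq> X (count_list w 1)"
    using snoc.prems p by (intro snoc.IH) (auto split: if_splits)
  also have "\<dots> \<subseteq> X (count_list (w @ [t]) 1)"
    using snoc.prems(2) by (intro chain_mono) auto
  finally show ?case using snoc.prems(1) p by auto
qed simp

lemma finite_adapted:
  assumes "count_list w 1 \<le> r"
  shows "finite {p. adapted X w p}"
proof (rule finite_subset)
  show "{p. adapted X w p} \<subseteq> {p. set p \<subseteq> X (count_list w 1) \<and> length p = length w}"
    using set_subset_if_adapted[OF _ assms] by (auto simp: adapted_def)
qed (use finite_chain[OF assms] in \<open>simp add: finite_lists_length_eq\<close>)

lemma card_adapted_snoc_0:
  assumes "count_list w 1 \<le> r"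
  shows "int (card {p. adapted X (w @ [0]) p}) =
    int (card {p. adapted X w p}) * (int (card (X (count_list w 1))) - int (length w))"
proof -
  let ?X = "X (count_list w 1)"
  have "card {p. adapted X (w @ [0]) p} = card (SIGMA q:{q. adapted X w q}. ?X - set q)"
    using bij_betw_same_card[OF bij_betw_adapted_snoc[of X w 0]] by (simp add: set_diff_eq)
  also have "\<dots> = (\<Sum>q | adapted X w q. card (?X - set q))"
    using finite_adapted[OF assms] finite_chain[OF assms] by (intro card_SigmaI) auto
  finally have "int (card {p. adapted X (w @ [0]) p}) =
      (\<Sum>q | adapted X w q. int (card (?X - set q)))" by simp
  also have "\<dots> = (\<Sum>q | adapted X w q. int (card ?X) - int (length w))"
  proof (intro sum.cong refl)
    fix q assume "q \<in> {q. adapted X w q}"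
    then have q: "adapted X w q" by simp
    then have "set q \<subseteq> ?X" "card (set q) = length w"
      using set_subset_if_adapted[OF q assms] by (auto simp: adapted_def distinct_card)
    then show "int (card (?X - set q)) = int (card ?X) - int (length w)"
      using card_mono[of ?X "set q"] finite_chain[OF assms]
      by (simp add: card_Diff_subset of_nat_diff)
  qed
  finally show ?thesis by simp
qed

text \<open>The prefix stays inside the current set, so an element outside it is automatically new
  and the choice is independent of the prefix.\<close>

lemma card_adapted_snoc_1:
  assumes "count_list w 1 < r"
  shows "card {p. adapted X (w @ [1]) p} = card {p. adapted X w p} *
    card (X (Suc (count_list w 1)) - X (count_list w 1))"
proof -
  let ?D = "X (Suc (count_list w 1)) - X (count_list w 1)"
  have "set q \<subseteq> X (count_list w 1)" if "adapted X w q" for q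
    using set_subset_if_adapted[OF that] assms by simp
  then have "(SIGMA q:{q. adapted X w q}. {x \<in> X (count_list (w @ [1]) 1).
        x \<notin> set q \<and> (1 = (1::nat) \<longrightarrow> x \<notin> X (count_list w 1))}) = {q. adapted X w q} \<times> ?D"
    by (intro Sigma_cong) auto
  then have "card {p. adapted X (w @ [1]) p} = card ({q. adapted X w q} \<times> ?D)"
    using bij_betw_same_card[OF bij_betw_adapted_snoc[of X w 1]] by (simp only:)
  then show ?thesis by (simp add: card_cartesian_product)
qed

lemma card_adapted_replicate_0:
  assumes "count_list w 1 \<le> r"
  shows "int (card {p. adapted X (w @ replicate m 0) p}) =
    int (card {p. adapted X w p}) *
    falling_fact (int (card (X (count_list w 1))) - int (length w)) m"
proof (induction m)
  case (Suc m)
  have eq: "w @ replicate (Suc m) 0 = (w @ replicate m 0) @ [0]"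
    by (simp flip: replicate_append_same)
  have cl: "count_list (w @ replicate m 0) 1 = count_list w 1"
    by (simp add: count_list_0_iff)
  have "int (card {p. adapted X (w @ replicate (Suc m) 0) p}) =
      int (card {p. adapted X (w @ replicate m 0) p}) *
      (int (card (X (count_list w 1))) - int (length w) - int m)"
    using card_adapted_snoc_0[of "w @ replicate m 0", unfolded cl] assms
    by (simp only: eq) simp
  then show ?case using Suc by (simp add: falling_fact_def)
qed (simp add: falling_fact_def)

end

section \<open>Compositions and their words\<close>

lemma composition_word_singleton: "composition_word [c] = replicate c 0"
  by (simp add: composition_word_def)

lemma composition_word_snoc:
  assumes "b \<noteq> []"
  shows "composition_word (b @ [c]) = composition_word b @ 1 # replicate (c - 1) 0"
proof -
  have "map (\<lambda>j. 1 # replicate ((b @ [c]) ! j - 1) 0) [1..<length b] =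
      map (\<lambda>j. 1 # replicate (b ! j - 1) (0::nat)) [1..<length b]"
    by (intro map_cong) (auto simp: nth_append)
  moreover have "[1..<length (b @ [c])] = [1..<length b] @ [length b]"
    using assms by (cases b) auto
  ultimately show ?thesis
    using assms by (simp only: composition_word_def map_append concat_append) (simp add: nth_append)
qed

text \<open>Recursion on the last part, which drives the inductions over compositions. The condition
  \<open>c \<le> n\<close> guards the truncated subtraction \<open>n - c\<close>.\<close>

lemma composition_snoc:
  "b @ [c] \<in> nr_compositions n (Suc r) \<longleftrightarrow> c > 0 \<and> c \<le> n \<and> b \<in> nr_compositions (n - c) r"
proof -
  have "(\<Sum>j\<le>r. (b @ [c]) ! j) = (\<Sum>j\<le>r. b ! j)" if "length b = Suc r"
    using that by (intro sum.cong) (auto simp: nth_append)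
  moreover have "(\<forall>j\<in>{1..Suc r}. (b @ [c]) ! j > 0) \<longleftrightarrow> c > 0 \<and> (\<forall>j\<in>{1..r}. b ! j > 0)"
    if "length b = Suc r"
    using that by (auto simp: atLeastAtMostSuc_conv) (auto simp: nth_append)
  moreover have "(b @ [c]) ! Suc r = c" if "length b = Suc r"
    using that by (simp add: nth_append)
  ultimately show ?thesis
    by (cases "length b = Suc r") (auto simp: nr_compositions_def simp del: One_nat_def)
qed

lemma composition_0: "b \<in> nr_compositions n 0 \<longleftrightarrow> b = [n]"
  by (auto simp: nr_compositions_def length_Suc_conv)

lemma length_composition: "b \<in> nr_compositions n r \<Longrightarrow> length b = Suc r"
  by (simp add: nr_compositions_def)

lemma finite_nr_compositions: "finite (nr_compositions n r)"
proof (rule finite_subset)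
  show "nr_compositions n r \<subseteq> {b. set b \<subseteq> {..n} \<and> length b = Suc r}"
  proof (clarsimp simp: nr_compositions_def set_conv_nth)
    fix b :: "nat list" and i
    assume "length b = Suc r" "i < Suc r"
    then show "b ! i \<le> (\<Sum>j\<le>r. b ! j)"
      by (intro member_le_sum) auto
  qed
qed (simp add: finite_lists_length_eq)

text \<open>Read from the right, the zeros before the first \<open>1\<close> determine
  \<open>k\<close>; the rest of the word is then determined by cancellation.\<close>

lemma snoc_1_replicate_0_inject:
  "u @ 1 # replicate k (0::nat) = v @ 1 # replicate l 0 \<longleftrightarrow> u = v \<and> k = l"
proof
  assume eq: "u @ 1 # replicate k (0::nat) = v @ 1 # replicate l 0"
  then have "rev (u @ 1 # replicate k (0::nat)) = rev (v @ 1 # replicate l 0)" by simp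
  then have *: "replicate k (0::nat) @ 1 # rev u = replicate l 0 @ 1 # rev v" by simp
  have "takeWhile (\<lambda>x. x = (0::nat)) (replicate m 0 @ 1 # z) = replicate m 0" for m z
    by (induction m) auto
  from arg_cong[OF *, of "takeWhile (\<lambda>x. x = 0)", unfolded this] have "k = l" by simp
  then show "u = v \<and> k = l" using eq by simp
qed simp

lemma inj_on_composition_word: "inj_on composition_word (nr_compositions n r)"
proof (induction r arbitrary: n)
  case 0
  then show ?case by (auto simp: inj_on_def composition_0)
next
  case (Suc r)
  show ?case
  proof (rule inj_onI)
    fix b b' assume bb: "b \<in> nr_compositions n (Suc r)" "b' \<in> nr_compositions n (Suc r)"
      and eq: "composition_word b = composition_word b'"
    obtain a c a' c' where ac: "b = a @ [c]" "b' = a' @ [c']"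
      using bb by (cases b rule: rev_cases; cases b' rule: rev_cases)
        (auto dest: length_composition)
    have mem: "c > 0" "a \<in> nr_compositions (n - c) r" "c' > 0" "a' \<in> nr_compositions (n - c') r"
      using bb by (auto simp: ac composition_snoc)
    then have "a \<noteq> []" "a' \<noteq> []" by (auto dest: length_composition)
    with eq have "composition_word a = composition_word a'" "c - 1 = c' - 1"
      by (simp_all add: ac composition_word_snoc snoc_1_replicate_0_inject del: One_nat_def)
    moreover from this(2) have "c = c'" using mem by simp
    ultimately show "b = b'"
      using inj_onD[OF Suc.IH[of "n - c"]] mem ac by simp
  qed
qed

text \<open>Appending \<open>1\<close> to a word opens a new part of size one; appending
  \<open>0\<close> enlarges the last part by one.\<close>

lemma composition_word_surj:
  "w \<in> nr_sequences n r \<Longrightarrow> \<exists>b\<in>nr_compositions n r. w = composition_word b"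
proof (induction w arbitrary: n r rule: rev_induct)
  case Nil
  then show ?case
    by (auto simp: nr_sequences_def composition_0 composition_word_singleton)
next
  case (snoc t w)
  have t: "t = 0 \<or> t = 1" using snoc.prems by (auto simp: nr_sequences_def)
  show ?case
  proof (cases "t = 1")
    case True
    define n' r' where "n' = n - 1" "r' = r - 1"
    with True snoc.prems have nr: "n = Suc n'" "r = Suc r'" "w \<in> nr_sequences n' r'"
      by (auto simp: nr_sequences_def)
    then obtain b where b: "b \<in> nr_compositions n' r'" "w = composition_word b"
      using snoc.IH by blast
    then have "b \<noteq> []" by (auto dest: length_composition)
    then have "w @ [t] = composition_word (b @ [1])"
      using b True by (simp add: composition_word_snoc)
    moreover have "b @ [1] \<in> nr_compositions n r"
      using b nr by (simp add: composition_snoc)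
    ultimately show ?thesis by blast
  next
    case False
    with t have t: "t = 0" by simp
    define n' where "n' = n - 1"
    with t snoc.prems have nr: "n = Suc n'" "w \<in> nr_sequences n' r"
      by (auto simp: nr_sequences_def)
    then obtain b where b: "b \<in> nr_compositions n' r" "w = composition_word b"
      using snoc.IH by blast
    show ?thesis
    \<comment> \<open>For \<open>r = 0\<close> the only part is the zeroth, whose block of zeros is
      not preceded by a \<open>1\<close>.\<close>
    proof (cases r)
      case 0
      then have "w @ [t] = composition_word [n]"
        using b t nr
        by (simp add: composition_0 composition_word_singleton replicate_append_same)
      then show ?thesis using 0 by (auto simp: composition_0)
    next
      case (Suc r')
      obtain a c where ac: "b = a @ [c]"
        using b by (cases b rule: rev_cases) (auto dest: length_composition)
      with b Suc have mem: "c > 0" "c \<le> n'" "a \<in> nr_compositions (n' - c) r'"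
        by (auto simp: composition_snoc)
      then have "a \<noteq> []" by (auto dest: length_composition)
      obtain d where d: "c = Suc d" using mem(1) by (cases c) auto
      have "w @ [t] = composition_word (a @ [Suc c])"
        using b t \<open>a \<noteq> []\<close> by (simp add: ac d composition_word_snoc replicate_append_same)
      moreover have "a @ [Suc c] \<in> nr_compositions n r"
        using mem nr Suc by (simp add: composition_snoc)
      ultimately show ?thesis by blast
    qed
  qed
qed

section \<open>Counting the adapted lists of a composition word\<close>

context set_chain
begin

lemma card_adapted_composition_word:
  assumes "b \<in> nr_compositions n m" "m \<le> r"
  shows "int (card {p. adapted X (composition_word b) p}) =
    falling_fact (int (card (X 0))) (b ! 0) *
    (\<Prod>j=1..<Suc m. int (card (X j - X (j - 1))) *
       falling_fact (int (card (X j)) - 1 - (\<Sum>i<j. int (b ! i))) (b ! j - 1))"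
  using assms
proof (induction m arbitrary: b n)
  case 0
  then have "b = [n]" by (simp add: composition_0)
  then show ?case
    using card_adapted_replicate_0[of "[]" n] by (simp add: composition_word_singleton)
next
  case (Suc m)
  obtain a c where b: "b = a @ [c]"
    using Suc.prems(1) by (cases b rule: rev_cases) (auto dest: length_composition)
  with Suc.prems(1) have a: "a \<in> nr_compositions (n - c) m" and c: "c > 0" "c \<le> n"
    by (auto simp: composition_snoc)
  have len: "length a = Suc m" using a by (rule length_composition)
  then have "a \<noteq> []" by auto
  let ?w = "composition_word a"
  have w: "length ?w = n - c" "count_list ?w 1 = m"
    using composition_word_in_nr_sequences[OF a] by (auto simp: nr_sequences_def)
  have suma: "(\<Sum>i<Suc m. int (b ! i)) = int (n - c)"
  proof -
    have "(\<Sum>i<Suc m. int (b ! i)) = (\<Sum>i<Suc m. int (a ! i))"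
      by (intro sum.cong) (auto simp: b nth_append len)
    also have "\<dots> = int (\<Sum>i\<le>m. a ! i)" by (simp only: lessThan_Suc_atMost of_nat_sum)
    also have "(\<Sum>i\<le>m. a ! i) = n - c" using a by (simp add: nr_compositions_def)
    finally show ?thesis .
  qed
  have prod_eq: "(\<Prod>j=1..<Suc m. int (card (X j - X (j - 1))) *
       falling_fact (int (card (X j)) - 1 - (\<Sum>i<j. int (a ! i))) (a ! j - 1)) =
     (\<Prod>j=1..<Suc m. int (card (X j - X (j - 1))) *
       falling_fact (int (card (X j)) - 1 - (\<Sum>i<j. int (b ! i))) (b ! j - 1))"
  proof (rule prod.cong[OF refl])
    fix j assume j: "j \<in> {1..<Suc m}"
    have "(\<Sum>i<j. int (a ! i)) = (\<Sum>i<j. int (b ! i))"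
      using j by (intro sum.cong) (auto simp: b nth_append len)
    moreover have "a ! j = b ! j" using j by (auto simp: b nth_append len)
    ultimately show "int (card (X j - X (j - 1))) *
       falling_fact (int (card (X j)) - 1 - (\<Sum>i<j. int (a ! i))) (a ! j - 1) =
      int (card (X j - X (j - 1))) *
       falling_fact (int (card (X j)) - 1 - (\<Sum>i<j. int (b ! i))) (b ! j - 1)"
      by simp
  qed
  have word: "composition_word b = (?w @ [1]) @ replicate (c - 1) 0"
    using composition_word_snoc[OF \<open>a \<noteq> []\<close>, of c] by (simp add: b)
  have cnt: "count_list (?w @ [1]) 1 = Suc m" using w by simp
  have "int (card {p. adapted X (composition_word b) p}) =
      int (card {p. adapted X (?w @ [1]) p}) *
      falling_fact (int (card (X (Suc m))) - int (Suc (n - c))) (c - 1)"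
    unfolding word using card_adapted_replicate_0[of "?w @ [1]" "c - 1", unfolded cnt] Suc.prems(2) w
    by simp
  also have "int (card {p. adapted X (?w @ [1]) p}) =
      int (card {p. adapted X ?w p}) * int (card (X (Suc m) - X m))"
    using card_adapted_snoc_1[of ?w, unfolded w] Suc.prems(2) by simp
  \<comment> \<open>The earlier blocks have total length \<open>n - c\<close>; the
    \<open>- 1\<close> accounts for the letter \<open>1\<close> that opens the last block.\<close>
  also have "int (card (X (Suc m))) - int (Suc (n - c)) =
      int (card (X (Suc m))) - 1 - (\<Sum>i<Suc m. int (b ! i))"
    by (simp only: suma)
  also have "c = b ! Suc m" using len by (simp add: b nth_append)
  also have "int (card {p. adapted X ?w p}) =
      falling_fact (int (card (X 0))) (b ! 0) *
      (\<Prod>j=1..<Suc m. int (card (X j - X (j - 1))) *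
       falling_fact (int (card (X j)) - 1 - (\<Sum>i<j. int (b ! i))) (b ! j - 1))"
    using Suc.IH[OF a] Suc.prems(2) prod_eq len by (simp add: b nth_append)
  finally show ?case by (simp add: prod.atLeastLessThan_Suc)
qed

end

section \<open>Compositions of flags\<close>

lemma length_flag_composition: "Xs \<noteq> [] \<Longrightarrow> length (flag_composition Xs) = length Xs"
  by (simp add: flag_composition_def)

lemma flag_composition_nth:
  "0 < j \<Longrightarrow> j < length Xs \<Longrightarrow> flag_composition Xs ! j = card (Xs ! j - Xs ! (j - 1))"
  by (cases j) (simp_all add: flag_composition_def)

lemma flag_composition_0: "flag_composition Xs ! 0 = card (Xs ! 0)"
  by (simp add: flag_composition_def)

lemma sum_flag_composition:
  assumes "set_chain ((!) Xs) r" "length Xs = Suc r" "j \<le> r"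
  shows "(\<Sum>i\<le>j. flag_composition Xs ! i) = card (Xs ! j)"
  using assms(3)
proof (induction j)
  case (Suc j)
  interpret set_chain "(!) Xs" r by fact
  have "Xs ! j \<subseteq> Xs ! Suc j" "finite (Xs ! Suc j)"
    using Suc.prems chain_mono finite_chain by auto
  then show ?case
    using Suc assms(2) card_mono[of "Xs ! Suc j" "Xs ! j"]
    by (simp add: flag_composition_nth card_Diff_subset finite_subset)
qed (simp add: flag_composition_0)

text \<open>The partial sums of the composition telescope to the sizes of the sets. Substituting
  this into the product formula for the count turns each falling factorial into the one in
  \<open>gamma_coeff\<close>.\<close>

lemma card_adapted_eq_gamma_coeff:
  assumes "set_chain ((!) Xs) r" "length Xs = Suc r" "b \<in> nr_compositions n r"
  shows "int (card {p. adapted ((!) Xs) (composition_word b) p}) =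
    gamma_coeff (flag_composition Xs) b"
proof -
  interpret set_chain "(!) Xs" r by fact
  have len: "length (flag_composition Xs) = Suc r"
    using assms(2) by (subst length_flag_composition) auto
  have "int (card (Xs ! j - Xs ! (j - 1))) *
       falling_fact (int (card (Xs ! j)) - 1 - (\<Sum>i<j. int (b ! i))) (b ! j - 1) =
     int (flag_composition Xs ! j) * falling_fact (int (flag_composition Xs ! j) - 1 +
       (\<Sum>i<j. int (flag_composition Xs ! i) - int (b ! i))) (b ! j - 1)"
    if j: "j \<in> {1..<Suc r}" for j
  proof -
    have "int (card (Xs ! j)) = (\<Sum>i\<le>j. int (flag_composition Xs ! i))"
      using sum_flag_composition[OF assms(1,2), of j] j by (simp flip: of_nat_sum)
    also have "\<dots> = (\<Sum>i<j. int (flag_composition Xs ! i)) + int (flag_composition Xs ! j)"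
      by (simp flip: lessThan_Suc_atMost)
    finally show ?thesis
      using j assms(2) by (simp add: flag_composition_nth sum_subtractf algebra_simps)
  qed
  then show ?thesis
    using card_adapted_composition_word[OF assms(3)]
    by (simp add: gamma_coeff_def len flag_composition_0 del: One_nat_def)
qed

section \<open>The flag of a permutation\<close>

lemma rank_sequence_snoc:
  "rank_sequence M (p @ [x]) =
     rank_sequence M p @ [mrank M (insert x (set p)) - mrank M (set p)]"
  by (simp add: rank_sequence_def)

lemma adapted_take: "adapted X w p \<Longrightarrow> adapted X (take i w) (take i p)"
  by (auto simp: adapted_def min_def)

lemma count_list_take_le: "count_list (take i w) y \<le> count_list w y"
  by (metis append_take_drop_id count_list_append le_add1)

context matroid
begin

lemma mrank_insert_cases:
  "mrank M (insert x A) = mrank M A \<or> mrank M (insert x A) = Suc (mrank M A)"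
  using mrank_insert_le[of x A] mrank_mono[OF subset_insertI[of A x]] by linarith

lemma count_rank_sequence: "count_list (rank_sequence M p) 1 = mrank M (set p)"
proof (induction p rule: rev_induct)
  case (snoc x p)
  then show ?case
    using mrank_insert_cases[of x "set p"] by (auto simp: rank_sequence_snoc)
qed (simp add: rank_sequence_def)

text \<open>A discrete intermediate value argument: the rank starts at \<open>0\<close> and grows by
  at most one with each element.\<close>

lemma ex_prefix_of_rank:
  "k \<le> mrank M (set p) \<Longrightarrow> \<exists>i\<le>length p. mrank M (set (take i p)) = k"
proof (induction p rule: rev_induct)
  case (snoc x p)
  show ?case
  proof (cases "k \<le> mrank M (set p)")
    case True
    then obtain i where "i \<le> length p" "mrank M (set (take i p)) = k" using snoc.IH by blast
    then show ?thesis by (intro exI[of _ i]) simp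
  next
    case False
    then have "k = mrank M (insert x (set p))"
      using snoc.prems mrank_insert_cases[of x "set p"] by auto
    then show ?thesis by (intro exI[of _ "Suc (length p)"]) simp
  qed
qed simp

text \<open>Prefixes are nested, and nested sets of equal rank have equal closures. Hence the flag
  of a permutation is well defined.\<close>

lemma mclosure_prefix_cong:
  assumes "mrank M (set (take i p)) = mrank M (set (take j p))"
  shows "mclosure M (set (take i p)) = mclosure M (set (take j p))"
proof (cases "i \<le> j")
  case True
  then show ?thesis
    using assms by (intro mclosure_eqI set_take_subset_set_take)
next
  case False
  then show ?thesis
    using assms by (intro mclosure_eqI[symmetric] set_take_subset_set_take) auto
qed

text \<open>Each element lies in the closure of the prefix ending with it, and an element that
  raises the rank lies outside the closure of the preceding prefix.\<close>

lemma adapted_rank_sequence: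
  assumes "distinct p" "set p \<subseteq> ground M"
    and "\<And>i. i \<le> length p \<Longrightarrow>
      X (mrank M (set (take i p))) = mclosure M (set (take i p))"
  shows "adapted X (rank_sequence M p) p"
  using assms
proof (induction p rule: rev_induct)
  case (snoc x p)
  have "adapted X (rank_sequence M p) p"
  proof (rule snoc.IH)
    fix i assume "i \<le> length p"
    then show "X (mrank M (set (take i p))) = mclosure M (set (take i p))"
      using snoc.prems(3)[of i] by simp
  qed (use snoc.prems in auto)
  moreover have "X (mrank M (insert x (set p))) = mclosure M (insert x (set p))"
    using snoc.prems(3)[of "Suc (length p)"] by simp
  then have "x \<in> X (mrank M (insert x (set p)))"
    using subset_mclosure[of "insert x (set p)"] snoc.prems(2) by auto
  moreover have "x \<notin> X (mrank M (set p))" if "mrank M (insert x (set p)) \<noteq> mrank M (set p)"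
    using snoc.prems(3)[of "length p"] that by (simp add: mclosure_def)
  moreover have "count_list (rank_sequence M p @ [mrank M (insert x (set p)) - mrank M (set p)]) 1 =
      mrank M (insert x (set p))"
    using count_rank_sequence[of "p @ [x]"] by (simp add: rank_sequence_snoc)
  ultimately show ?case
    using snoc.prems(1) count_rank_sequence[of p]
    by (auto simp only: rank_sequence_snoc adapted_snoc) auto
qed (simp add: rank_sequence_def)

section \<open>Flags as chains of sets\<close>

lemma mflag_length: "mflag M Xs \<Longrightarrow> length Xs = Suc (mrank M (ground M))"
  by (simp add: mflag_def Let_def)

lemma mflag_flat: "mflag M Xs \<Longrightarrow> j \<le> mrank M (ground M) \<Longrightarrow> mflat M (Xs ! j)"
  by (simp add: mflag_def Let_def)

lemma mflag_rank: "mflag M Xs \<Longrightarrow> j \<le> mrank M (ground M) \<Longrightarrow> mrank M (Xs ! j) = j"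
  by (simp add: mflag_def Let_def)

lemma mflag_strict: "mflag M Xs \<Longrightarrow> j < mrank M (ground M) \<Longrightarrow> Xs ! j \<subset> Xs ! Suc j"
  by (simp add: mflag_def Let_def)

lemma mflag_last: "mflag M Xs \<Longrightarrow> Xs ! mrank M (ground M) = ground M"
  by (simp add: mflag_def Let_def)

lemma mflag_subset_ground:
  "mflag M Xs \<Longrightarrow> j \<le> mrank M (ground M) \<Longrightarrow> Xs ! j \<subseteq> ground M"
  using mflag_flat by (simp add: mflat_def)

lemma mflag_set_chain:
  assumes "mflag M Xs"
  shows "set_chain ((!) Xs) (mrank M (ground M))"
proof
  fix j assume "j \<le> mrank M (ground M)"
  then show "finite (Xs ! j)"
    using mflag_subset_ground[OF assms] finite_ground finite_subset by blast
next
  fix i j assume "i \<le> j" "j \<le> mrank M (ground M)"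
  then show "Xs ! i \<subseteq> Xs ! j"
  proof (induction j rule: dec_induct)
    case (step k)
    then show ?case using mflag_strict[OF assms, of k] by auto
  qed simp
qed

lemma finite_mflags: "finite {Xs. mflag M Xs}"
proof (rule finite_subset)
  show "{Xs. mflag M Xs} \<subseteq>
      {Xs. set Xs \<subseteq> Pow (ground M) \<and> length Xs = Suc (mrank M (ground M))}"
    using mflag_length mflag_subset_ground by (fastforce simp: in_set_conv_nth less_Suc_eq_le)
qed (use finite_ground in \<open>simp add: finite_lists_length_eq\<close>)

lemma flag_composition_in_nr_compositions:
  assumes "mflag M Xs"
  shows "flag_composition Xs \<in> nr_compositions (card (ground M)) (mrank M (ground M))"
proof -
  let ?r = "mrank M (ground M)"
  note len = mflag_length[OF assms]
  have "flag_composition Xs ! j > 0" if j: "j \<in> {1..?r}" for j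
  proof -
    have "Xs ! (j - 1) \<subset> Xs ! j" using mflag_strict[OF assms, of "j - 1"] j by (cases j) auto
    moreover have "finite (Xs ! j)"
      using set_chain.finite_chain[OF mflag_set_chain[OF assms]] j by simp
    ultimately have "card (Xs ! j - Xs ! (j - 1)) > 0" by (auto simp: card_gt_0_iff)
    then show ?thesis using j len by (simp add: flag_composition_nth)
  qed
  moreover have "(\<Sum>j\<le>?r. flag_composition Xs ! j) = card (ground M)"
    using sum_flag_composition[OF mflag_set_chain[OF assms] len, of ?r] mflag_last[OF assms]
    by simp
  moreover have "length (flag_composition Xs) = Suc ?r"
    using len by (subst length_flag_composition) auto
  ultimately show ?thesis by (simp add: nr_compositions_def)
qed

text \<open>The invariant is that a prefix spans the current flat. An element outside the flat then
  raises the rank, and one inside it does not, so the rank sequence spells \<open>w\<close>.\<close>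

lemma mrank_set_if_adapted:
  assumes "mflag M Xs" "adapted ((!) Xs) w p" "set w \<subseteq> {0, 1}"
    and "count_list w 1 \<le> mrank M (ground M)"
  shows "mrank M (set p) = count_list w 1 \<and> rank_sequence M p = w"
  using assms(2-)
proof (induction w arbitrary: p rule: rev_induct)
  case Nil
  then show ?case by (simp add: rank_sequence_def)
next
  case (snoc t w)
  let ?k = "count_list w 1"
  from snoc.prems(1) obtain q x where p: "p = q @ [x]" by (rule adapted_snocE)
  have q: "adapted ((!) Xs) w q" and x: "x \<in> Xs ! count_list (w @ [t]) 1"
    "t = 1 \<Longrightarrow> x \<notin> Xs ! ?k"
    using snoc.prems(1) p by simp_all
  have k: "?k \<le> mrank M (ground M)" using snoc.prems(3) by simp
  have IH: "mrank M (set q) = ?k" "rank_sequence M q = w"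
    using snoc.IH[OF q] snoc.prems(2) k by auto
  have sub: "set q \<subseteq> Xs ! ?k"
    by (rule set_chain.set_subset_if_adapted[OF mflag_set_chain[OF assms(1)] q k])
  have rk: "mrank M (Xs ! ?k) = ?k" using mflag_rank[OF assms(1) k] .
  have "mrank M (insert x (set q)) = ?k + t"
  proof (cases "t = 1")
    case True
    have "Xs ! ?k = mclosure M (set q)"
      using mflat_eq_mclosure[OF mflag_flat[OF assms(1) k] sub] IH rk by simp
    moreover have "x \<in> ground M"
      using x(1) mflag_subset_ground[OF assms(1) snoc.prems(3)] by auto
    ultimately have "mrank M (insert x (set q)) \<noteq> mrank M (set q)"
      using x(2)[OF True] by (simp add: mclosure_def)
    then show ?thesis using mrank_insert_cases[of x "set q"] IH True by simp
  next
    case False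
    then have "t = 0" using snoc.prems(2) by simp
    then have "insert x (set q) \<subseteq> Xs ! ?k" using x(1) sub by simp
    then show ?thesis
      using mrank_mono[of "insert x (set q)" "Xs ! ?k"] mrank_insert_cases[of x "set q"]
        IH rk \<open>t = 0\<close> by simp
  qed
  then show ?case using IH snoc.prems(2) p by (auto simp: rank_sequence_snoc)
qed

lemma mflag_eq_mclosure_prefix:
  assumes "mflag M Xs" "adapted ((!) Xs) w p" "set w \<subseteq> {0, 1}"
    and "count_list w 1 \<le> mrank M (ground M)"
  shows "Xs ! mrank M (set (take i p)) = mclosure M (set (take i p))"
proof -
  let ?w = "take i w"
  have ad: "adapted ((!) Xs) ?w (take i p)" using assms(2) by (rule adapted_take)
  have k: "count_list ?w 1 \<le> mrank M (ground M)"
    using count_list_take_le[of i w] assms(4) by (rule order_trans)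
  have "set ?w \<subseteq> {0, 1}" using assms(3) set_take_subset[of i w] by (rule order_trans[rotated])
  then have rk: "mrank M (set (take i p)) = count_list ?w 1"
    using mrank_set_if_adapted[OF assms(1) ad _ k] by simp
  show ?thesis
    unfolding rk
    using set_chain.set_subset_if_adapted[OF mflag_set_chain[OF assms(1)] ad k]
      mflag_flat[OF assms(1) k] mflag_rank[OF assms(1) k] rk
    by (intro mflat_eq_mclosure) auto
qed

text \<open>The list has full rank, so every \<open>k\<close> is the rank of some prefix, and the
  closure of that prefix must be the \<open>k\<close>-th flat of either flag.\<close>

lemma adapted_mflag_unique:
  assumes w: "w \<in> nr_sequences n (mrank M (ground M))"
    and Xs: "mflag M Xs" "adapted ((!) Xs) w p"
    and Ys: "mflag M Ys" "adapted ((!) Ys) w p"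
  shows "Xs = Ys"
proof (rule nth_equalityI)
  show "length Xs = length Ys" using mflag_length Xs(1) Ys(1) by metis
  have w': "set w \<subseteq> {0, 1}" "count_list w 1 = mrank M (ground M)"
    using w by (auto simp: nr_sequences_def)
  fix k assume "k < length Xs"
  then have "k \<le> mrank M (ground M)" using mflag_length[OF Xs(1)] by simp
  then have "k \<le> mrank M (set p)" using mrank_set_if_adapted[OF Xs w'(1)] w'(2) by simp
  then obtain i where "mrank M (set (take i p)) = k" using ex_prefix_of_rank by blast
  then show "Xs ! k = Ys ! k"
    using mflag_eq_mclosure_prefix[OF Xs w'(1), of i] mflag_eq_mclosure_prefix[OF Ys w'(1), of i] w'(2)
    by simp
qed

lemma ex_adapted_mflag:
  assumes "p \<in> permutations_of_set (ground M)"
  shows "\<exists>Xs. mflag M Xs \<and> adapted ((!) Xs) (rank_sequence M p) p"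
proof -
  let ?r = "mrank M (ground M)"
  have p: "set p = ground M" "distinct p" using assms by (auto simp: permutations_of_set_def)
  have "\<forall>k\<in>{..?r}. \<exists>i\<le>length p. mrank M (set (take i p)) = k"
    using ex_prefix_of_rank[of _ p] p by auto
  then obtain f where f: "\<And>k. k \<le> ?r \<Longrightarrow> mrank M (set (take (f k) p)) = k"
    by (metis atMost_iff)
  \<comment> \<open>For each rank, \<open>f\<close> selects some prefix of that rank; the fact
    \<open>prefix\<close> below shows that the selection does not affect the closure.\<close>
  define Xs where "Xs = map (\<lambda>k. mclosure M (set (take (f k) p))) [0..<Suc ?r]"
  have nth: "Xs ! k = mclosure M (set (take (f k) p))" if "k \<le> ?r" for k
    using that unfolding Xs_def by (subst nth_map) (auto simp del: upt_Suc)
  have sub: "set (take i p) \<subseteq> ground M" for i using set_take_subset[of i p] p by simp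
  have rk: "mrank M (Xs ! k) = k" if "k \<le> ?r" for k
    using that by (simp add: nth mrank_mclosure sub f)
  have "Xs ! k \<subset> Xs ! Suc k" if k: "k < ?r" for k
  proof -
    \<comment> \<open>Although \<open>f\<close> is an arbitrary choice, a prefix of larger rank
      cannot be shorter.\<close>
    have "f k \<le> f (Suc k)"
    proof (rule ccontr)
      assume "\<not> f k \<le> f (Suc k)"
      then have "mrank M (set (take (f (Suc k)) p)) \<le> mrank M (set (take (f k) p))"
        by (intro mrank_mono set_take_subset_set_take) simp
      then show False using f k by simp
    qed
    then have "Xs ! k \<subseteq> Xs ! Suc k"
      using k nth by (simp add: mclosure_mono set_take_subset_set_take)
    moreover have "Xs ! k \<noteq> Xs ! Suc k"
      using rk[of k] rk[of "Suc k"] k by auto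
    ultimately show ?thesis by blast
  qed
  moreover have prefix: "Xs ! mrank M (set (take i p)) = mclosure M (set (take i p))" for i
  proof -
    have k: "mrank M (set (take i p)) \<le> ?r" using mrank_mono[OF sub] .
    show ?thesis using nth[OF k] mclosure_prefix_cong[OF f[OF k]] by (rule trans)
  qed
  moreover have "Xs ! ?r = ground M"
    using prefix[of "length p"] subset_mclosure[of "ground M"] mclosure_subset_ground[of "ground M"]
    by (simp add: p)
  moreover have "length Xs = Suc ?r" by (simp add: Xs_def)
  ultimately have "mflag M Xs"
    using rk nth mflat_mclosure[OF sub] by (simp add: mflag_def Let_def)
  moreover have "adapted ((!) Xs) (rank_sequence M p) p"
    using p prefix by (intro adapted_rank_sequence) auto
  ultimately show ?thesis by blast
qed

section \<open>Partition of the permutations by flags\<close>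

lemma permutations_eq_UN_adapted:
  assumes w: "w \<in> nr_sequences (card (ground M)) (mrank M (ground M))"
  shows "{p \<in> permutations_of_set (ground M). rank_sequence M p = w} =
    (\<Union>Xs\<in>{Xs. mflag M Xs}. {p. adapted ((!) Xs) w p})"
proof -
  have w': "set w \<subseteq> {0, 1}" "count_list w 1 = mrank M (ground M)" "length w = card (ground M)"
    using w by (auto simp: nr_sequences_def)
  have "p \<in> permutations_of_set (ground M) \<and> rank_sequence M p = w"
    if Xs: "mflag M Xs" "adapted ((!) Xs) w p" for Xs p
  proof -
    have "set p \<subseteq> ground M"
      using set_chain.set_subset_if_adapted[OF mflag_set_chain[OF Xs(1)] Xs(2)] w'(2)
        mflag_last[OF Xs(1)] by simp
    moreover have "distinct p" "length p = card (ground M)"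
      using Xs(2) w'(3) by (auto simp: adapted_def)
    \<comment> \<open>An adapted list has as many distinct entries as the ground set has
      elements.\<close>
    ultimately have "set p = ground M"
      using card_subset_eq[OF finite_ground] by (simp add: distinct_card)
    then show ?thesis
      using \<open>distinct p\<close> mrank_set_if_adapted[OF Xs w'(1)] w'(2)
      by (simp add: permutations_of_set_def)
  qed
  moreover have "\<exists>Xs. mflag M Xs \<and> adapted ((!) Xs) w p"
    if "p \<in> permutations_of_set (ground M)" "rank_sequence M p = w" for p
    using ex_adapted_mflag that by blast
  ultimately show ?thesis by auto
qed

text \<open>The permutations with the given rank sequence split disjointly by flag. The contribution
  of a flag depends only on its composition, so grouping by composition brings in
  \<open>nu\<close>.\<close>

lemma card_permutations_eq_sum_nu:
  assumes b: "b \<in> nr_compositions (card (ground M)) (mrank M (ground M))"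
  shows "int (card {p \<in> permutations_of_set (ground M). rank_sequence M p = composition_word b}) =
    (\<Sum>a\<in>nr_compositions (card (ground M)) (mrank M (ground M)). int (nu M a) * gamma_coeff a b)"
proof -
  let ?C = "nr_compositions (card (ground M)) (mrank M (ground M))"
  let ?w = "composition_word b" and ?F = "{Xs. mflag M Xs}"
  note w = composition_word_in_nr_sequences[OF b]
  have fin: "finite {p. adapted ((!) Xs) ?w p}" if "mflag M Xs" for Xs
    using set_chain.finite_adapted[OF mflag_set_chain[OF that]] w by (simp add: nr_sequences_def)
  have "card {p \<in> permutations_of_set (ground M). rank_sequence M p = ?w} =
      (\<Sum>Xs\<in>?F. card {p. adapted ((!) Xs) ?w p})"
    unfolding permutations_eq_UN_adapted[OF w]
    using finite_mflags fin adapted_mflag_unique[OF w] by (intro card_UN_disjoint) auto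
  then have "int (card {p \<in> permutations_of_set (ground M). rank_sequence M p = ?w}) =
      (\<Sum>Xs\<in>?F. int (card {p. adapted ((!) Xs) ?w p}))"
    by simp
  also have "\<dots> = (\<Sum>Xs\<in>?F. gamma_coeff (flag_composition Xs) b)"
    using card_adapted_eq_gamma_coeff[OF mflag_set_chain mflag_length b]
    by (intro sum.cong) auto
  also have "\<dots> = (\<Sum>a\<in>?C. \<Sum>Xs\<in>{Xs \<in> ?F. flag_composition Xs = a}. gamma_coeff (flag_composition Xs) b)"
    using flag_composition_in_nr_compositions
    by (intro sum.group[symmetric] finite_mflags finite_nr_compositions) auto
  also have "\<dots> = (\<Sum>a\<in>?C. int (nu M a) * gamma_coeff a b)"
    by (intro sum.cong refl) (simp add: nu_def)
  finally show ?thesis .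
qed

end

section \<open>Triangularity\<close>

lemma falling_fact_eq_0: "0 \<le> t \<Longrightarrow> t < int k \<Longrightarrow> falling_fact t k = 0"
  unfolding falling_fact_def by (rule prod_zero) (auto intro!: bexI[of _ "nat t"])

lemma falling_fact_neq_0: "int k \<le> t \<Longrightarrow> falling_fact t k \<noteq> 0"
  by (auto simp: falling_fact_def)

text \<open>At the first index where dominance fails, the falling factorial has a nonnegative
  argument smaller than its number of factors, so one factor is zero. Thus the restricted sum in
  \<open>gamma\<close> agrees with the sum over all compositions.\<close>

lemma gamma_coeff_eq_0:
  assumes a: "a \<in> nr_compositions n r" and b: "b \<in> nr_compositions n r"
    and nd: "\<not> dominates b a"
  shows "gamma_coeff a b = 0"
proof -
  have len: "length a = Suc r" "length b = Suc r" using a b by (auto dest: length_composition)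
  let ?P = "\<lambda>j. j \<le> r \<and> (\<Sum>i\<le>j. a ! i) < (\<Sum>i\<le>j. b ! i)"
  define j where "j = (LEAST j. ?P j)"
  have "\<exists>j. ?P j" using nd len by (auto simp: dominates_def not_le less_Suc_eq_le)
  then have j: "?P j" unfolding j_def by (rule LeastI_ex)
  have less: "\<not> ?P i" if "i < j" for i using that unfolding j_def by (rule not_less_Least)
  show ?thesis
  proof (cases j)
    case 0
    then have "falling_fact (int (a ! 0)) (b ! 0) = 0"
      using j by (intro falling_fact_eq_0) auto
    then show ?thesis by (simp add: gamma_coeff_def)
  next
    case (Suc k)
    \<comment> \<open>The surplus before index \<open>j\<close>; it is nonnegative by minimality of
      \<open>j\<close>, while failure at \<open>j\<close> gives
      \<open>a ! j - 1 + d < b ! j - 1\<close>.\<close>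
    define d where "d = (\<Sum>i<j. int (a ! i) - int (b ! i))"
    have d: "d = int (\<Sum>i\<le>k. a ! i) - int (\<Sum>i\<le>k. b ! i)"
      by (simp add: d_def Suc lessThan_Suc_atMost sum_subtractf)
    have "a ! j > 0" using a j Suc by (auto simp: nr_compositions_def)
    moreover have "(\<Sum>i\<le>k. b ! i) \<le> (\<Sum>i\<le>k. a ! i)" using less[of k] j Suc by simp
    moreover have "(\<Sum>i\<le>k. a ! i) + a ! j < (\<Sum>i\<le>k. b ! i) + b ! j" using j Suc by simp
    ultimately have "falling_fact (int (a ! j) - 1 + d) (b ! j - 1) = 0"
      using d by (intro falling_fact_eq_0) linarith+
    then have "(\<Prod>j=1..<length a. int (a ! j) *
        falling_fact (int (a ! j) - 1 + (\<Sum>i<j. int (a ! i) - int (b ! i))) (b ! j - 1)) = 0"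
      using j Suc len by (intro prod_zero bexI[of _ j]) (auto simp: d_def)
    then show ?thesis by (simp add: gamma_coeff_def)
  qed
qed

text \<open>For \<open>b = a\<close> the correction sums vanish and the falling factorials become
  ordinary factorials.\<close>

lemma gamma_coeff_diag_neq_0:
  assumes a: "a \<in> nr_compositions n r"
  shows "gamma_coeff a a \<noteq> 0"
proof -
  have "a ! j > 0" if "j \<in> {1..<length a}" for j
    using that a by (auto simp: nr_compositions_def)
  then have "falling_fact (int (a ! j) - 1) (a ! j - 1) \<noteq> 0 \<and> a ! j \<noteq> 0"
    if "j \<in> {1..<length a}" for j
    using that by (intro conjI falling_fact_neq_0) force+
  then show ?thesis
    by (simp add: gamma_coeff_def falling_fact_neq_0 del: One_nat_def)
qed

text \<open>Strictly monotone along dominance, so a maximiser is an extremal composition.\<close>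

definition partial_sums_total :: "nat list \<Rightarrow> nat" where
  "partial_sums_total a = (\<Sum>j<length a. \<Sum>i\<le>j. a ! i)"

text \<open>Termwise inequalities between partial sums with no gap in the total are equalities, and
  the partial sums determine the parts.\<close>

lemma dominates_eqI:
  assumes dom: "dominates b a" and le: "partial_sums_total a \<le> partial_sums_total b"
  shows "a = b"
proof -
  have len: "length b = length a" and
    ps: "\<And>j. j < length a \<Longrightarrow> (\<Sum>i\<le>j. b ! i) \<le> (\<Sum>i\<le>j. a ! i)"
    using dom by (auto simp: dominates_def)
  have "partial_sums_total b \<le> partial_sums_total a"
    unfolding partial_sums_total_def len by (rule sum_mono) (simp add: ps)
  with le have "(\<Sum>j<length a. \<Sum>i\<le>j. b ! i) = (\<Sum>j<length a. \<Sum>i\<le>j. a ! i)"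
    by (simp add: partial_sums_total_def len)
  then have eq: "(\<Sum>i\<le>j. b ! i) = (\<Sum>i\<le>j. a ! i)" if "j < length a" for j
    using sum_mono_inv[of "\<lambda>j. \<Sum>i\<le>j. b ! i" "{..<length a}" "\<lambda>j. \<Sum>i\<le>j. a ! i" j] ps that
    by auto
  show ?thesis
  proof (rule nth_equalityI)
    show "length a = length b" using len by simp
    fix j assume j: "j < length a"
    show "a ! j = b ! j"
    proof (cases j)
      case 0
      then show ?thesis using eq[OF j] by simp
    next
      case (Suc k)
      then show ?thesis using eq[OF j] eq[of k] j by simp
    qed
  qed
qed

text \<open>Triangular elimination: among the compositions with nonzero \<open>d\<close> take
  \<open>b\<close> with the largest \<open>partial_sums_total\<close>. In the equation for
  \<open>b\<close> only the diagonal term survives, and its coefficient is nonzero.\<close>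

lemma gamma_coeff_combination_eq_0:
  fixes d :: "nat list \<Rightarrow> int"
  assumes zero: "\<And>b. b \<in> nr_compositions n r \<Longrightarrow>
      (\<Sum>a\<in>nr_compositions n r. d a * gamma_coeff a b) = 0"
    and a: "a \<in> nr_compositions n r"
  shows "d a = 0"
proof (rule ccontr)
  let ?C = "nr_compositions n r"
  let ?D = "{a \<in> ?C. d a \<noteq> 0}"
  assume "d a \<noteq> 0"
  then have D: "finite ?D" "?D \<noteq> {}" using a finite_nr_compositions by auto
  have "Max (partial_sums_total ` ?D) \<in> partial_sums_total ` ?D"
    using D by (intro Max_in) auto
  then obtain b where Max: "Max (partial_sums_total ` ?D) = partial_sums_total b" and b: "b \<in> ?D"
    by (rule imageE)
  have max: "partial_sums_total c \<le> partial_sums_total b" if "c \<in> ?D" for c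
    unfolding Max[symmetric] by (intro Max_ge finite_imageI imageI D(1) that)
  \<comment> \<open>If \<open>d c\<close> is nonzero and \<open>b\<close> dominates
    \<open>c\<close>, maximality of \<open>b\<close> forces \<open>c = b\<close>.\<close>
  have "d c * gamma_coeff c b = 0" if c: "c \<in> ?C" "c \<noteq> b" for c
  proof (cases "d c = 0 \<or> \<not> dominates b c")
    case True
    then show ?thesis using gamma_coeff_eq_0[OF c(1)] b by auto
  next
    case False
    then show ?thesis using dominates_eqI[of b c] max[of c] c by auto
  qed
  then have "(\<Sum>c\<in>?C. d c * gamma_coeff c b) = (\<Sum>c\<in>{b}. d c * gamma_coeff c b)"
    using b finite_nr_compositions by (intro sum.mono_neutral_right) auto
  then have "d b * gamma_coeff b b = 0" using zero b by simp
  then show False using b gamma_coeff_diag_neq_0 by auto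
qed

section \<open>Coefficients of the \<open>\<G>\<close>-invariant\<close>

lemma lookup_vscale: "Poly_Mapping.lookup (vscale c x) w = c * Poly_Mapping.lookup x w"
  by (simp add: vscale_def map.rep_eq when_def)

lemma lookup_gamma_composition_word:
  assumes a: "a \<in> nr_compositions n r" and b: "b \<in> nr_compositions n r"
  shows "Poly_Mapping.lookup (gamma n r a :: nat list \<Rightarrow>\<^sub>0 'k::field_char_0) (composition_word b) =
    of_int (gamma_coeff a b)"
proof -
  let ?D = "{b \<in> nr_compositions n r. dominates b a}"
  have "Poly_Mapping.lookup (gamma n r a :: nat list \<Rightarrow>\<^sub>0 'k) (composition_word b) =
      (\<Sum>c\<in>?D. if c = b then of_int (gamma_coeff a c) else 0)"
    \<comment> \<open>Distinct compositions have distinct words, so only the summand with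
      \<open>c = b\<close> can contribute.\<close>
    unfolding gamma_def lookup_sum
    using inj_onD[OF inj_on_composition_word[of n r]] b
    by (intro sum.cong refl) (auto simp: lookup_vscale lookup_single when_def)
  also have "\<dots> = of_int (gamma_coeff a b)"
    using finite_nr_compositions[of n r] gamma_coeff_eq_0[OF a b] b by simp
  finally show ?thesis .
qed

lemma lookup_G_invariant:
  "Poly_Mapping.lookup (G_invariant M :: nat list \<Rightarrow>\<^sub>0 'k::field_char_0) w =
     of_nat (card {p \<in> permutations_of_set (ground M). rank_sequence M p = w})"
proof -
  have "Poly_Mapping.lookup (G_invariant M :: nat list \<Rightarrow>\<^sub>0 'k) w =
      (\<Sum>p\<in>permutations_of_set (ground M). if rank_sequence M p = w then 1 else 0)"
    by (simp add: G_invariant_def lookup_sum lookup_single when_def)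
  also have "\<dots> = (\<Sum>p\<in>{p \<in> permutations_of_set (ground M). rank_sequence M p = w}. 1)"
    by (intro sum.inter_filter[symmetric]) simp
  finally show ?thesis by simp
qed

text \<open>Every basis symbol of the space is indexed by the word of a composition, so coefficients
  need comparing only at such words.\<close>

lemma G_space_eqI:
  assumes "x \<in> G_space n r" "y \<in> G_space n r"
    and "\<And>b. b \<in> nr_compositions n r \<Longrightarrow>
      Poly_Mapping.lookup x (composition_word b) = Poly_Mapping.lookup y (composition_word b)"
  shows "x = y"
proof (rule poly_mapping_eqI)
  fix w
  show "Poly_Mapping.lookup x w = Poly_Mapping.lookup y w"
  proof (cases "w \<in> nr_sequences n r")
    case True
    then show ?thesis using composition_word_surj assms(3) by metis
  next
    case False
    then have "w \<notin> Poly_Mapping.keys x" "w \<notin> Poly_Mapping.keys y"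
      using assms(1,2) by (auto simp: G_space_def)
    then show ?thesis by (simp add: in_keys_iff)
  qed
qed

text \<open>Comparing coefficients at the word of \<open>b\<close> reduces the identity to the
  integer count of permutations with that rank sequence.\<close>

lemma (in matroid) G_invariant_eq_sum_gamma:
  "(G_invariant M :: nat list \<Rightarrow>\<^sub>0 'k::field_char_0) =
    (\<Sum>a\<in>nr_compositions (card (ground M)) (mrank M (ground M)).
       vscale (of_nat (nu M a)) (gamma (card (ground M)) (mrank M (ground M)) a))"
    (is "_ = ?S")
proof (rule G_space_eqI[OF G_invariant_in_G_space])
  let ?n = "card (ground M)" and ?r = "mrank M (ground M)"
  have "Poly_Mapping.keys (vscale c (gamma ?n ?r a)) \<subseteq> nr_sequences ?n ?r" for c :: 'k and a
  proof -
    have "(gamma ?n ?r a :: nat list \<Rightarrow>\<^sub>0 'k) \<in> G_space ?n ?r" by (rule gamma_in_G_space)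
    then show ?thesis by (auto simp: G_space_def in_keys_iff lookup_vscale)
  qed
  then show "?S \<in> G_space ?n ?r"
    unfolding G_space_def by (fastforce dest!: subsetD[OF keys_sum])
  fix b assume b: "b \<in> nr_compositions ?n ?r"
  have "Poly_Mapping.lookup (G_invariant M :: nat list \<Rightarrow>\<^sub>0 'k) (composition_word b) =
      of_int (int (card {p \<in> permutations_of_set (ground M).
        rank_sequence M p = composition_word b}))"
    by (simp add: lookup_G_invariant)
  also have "\<dots> = Poly_Mapping.lookup ?S (composition_word b)"
    unfolding card_permutations_eq_sum_nu[OF b]
    by (simp add: lookup_sum lookup_vscale lookup_gamma_composition_word b)
  finally show "Poly_Mapping.lookup (G_invariant M :: nat list \<Rightarrow>\<^sub>0 'k) (composition_word b) =
      Poly_Mapping.lookup ?S (composition_word b)" .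
qed

lemma nu_eq_if_G_invariant_eq:
  assumes M: "matroid M" and M': "matroid M'"
    and n: "card (ground M) = n" "card (ground M') = n"
    and r: "mrank M (ground M) = r" "mrank M' (ground M') = r"
    and eq: "(G_invariant M :: nat list \<Rightarrow>\<^sub>0 'k::field_char_0) = G_invariant M'"
    and a: "a \<in> nr_compositions n r"
  shows "nu M a = nu M' a"
proof -
  \<comment> \<open>The triangular system is applied to the difference of the two catenary
    data.\<close>
  have "int (nu M a) - int (nu M' a) = 0"
  proof (rule gamma_coeff_combination_eq_0[OF _ a])
    fix b assume b: "b \<in> nr_compositions n r"
    \<comment> \<open>Characteristic zero is what turns equality of coefficients in the field into
      equality of cardinalities.\<close>
    have "card {p \<in> permutations_of_set (ground M). rank_sequence M p = composition_word b} =
        card {p \<in> permutations_of_set (ground M'). rank_sequence M' p = composition_word b}"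
      using arg_cong[OF eq, of "\<lambda>x. Poly_Mapping.lookup x (composition_word b)"]
      by (simp add: lookup_G_invariant)
    then have "(\<Sum>a\<in>nr_compositions n r. int (nu M a) * gamma_coeff a b) =
        (\<Sum>a\<in>nr_compositions n r. int (nu M' a) * gamma_coeff a b)"
      using matroid.card_permutations_eq_sum_nu[OF M, of b]
        matroid.card_permutations_eq_sum_nu[OF M', of b] b n r by simp
    then show "(\<Sum>a\<in>nr_compositions n r. (int (nu M a) - int (nu M' a)) * gamma_coeff a b) = 0"
      by (simp add: left_diff_distrib sum_subtractf)
  qed
  then show ?thesis by simp
qed

theorem theorem3p3:
  fixes M :: "'a indep_system" and n r :: nat
  assumes "matroid M" and "card (ground M) = n" and "mrank M (ground M) = r"
  shows "(\<forall>M' :: 'b indep_system.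
            matroid M' \<and> card (ground M') = n \<and> mrank M' (ground M') = r \<longrightarrow>
            ((G_invariant M :: nat list \<Rightarrow>\<^sub>0 'k::field_char_0) = G_invariant M' \<longleftrightarrow>
             catenary_data M = catenary_data M')) \<and>
         (G_invariant M :: nat list \<Rightarrow>\<^sub>0 'k) =
           (\<Sum>a\<in>nr_compositions n r. vscale (of_nat (nu M a)) (gamma n r a))"
proof (intro conjI allI impI)
  show formula: "(G_invariant M :: nat list \<Rightarrow>\<^sub>0 'k) =
      (\<Sum>a\<in>nr_compositions n r. vscale (of_nat (nu M a)) (gamma n r a))"
    using matroid.G_invariant_eq_sum_gamma[OF assms(1)] assms(2,3) by simp
  fix M' :: "'b indep_system"
  assume M': "matroid M' \<and> card (ground M') = n \<and> mrank M' (ground M') = r"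
  show "(G_invariant M :: nat list \<Rightarrow>\<^sub>0 'k) = G_invariant M' \<longleftrightarrow>
      catenary_data M = catenary_data M'"
  proof
    assume "(G_invariant M :: nat list \<Rightarrow>\<^sub>0 'k) = G_invariant M'"
    then have "nu M a = nu M' a" if "a \<in> nr_compositions n r" for a
      using nu_eq_if_G_invariant_eq[OF assms(1), of M' n r a] M' assms(2,3) that by blast
    \<comment> \<open>Both functions are restricted to the same index set, since \<open>n\<close>
      and \<open>r\<close> agree, and share the default value outside it.\<close>
    then show "catenary_data M = catenary_data M'"
      using M' assms(2,3) by (simp add: catenary_data_def restrict_def fun_eq_iff)
  next
    assume eq: "catenary_data M = catenary_data M'"
    have "nu M a = nu M' a" if "a \<in> nr_compositions n r" for a
      using fun_cong[OF eq, of a] M' assms(2,3) that by (simp add: catenary_data_def)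
    then have "(\<Sum>a\<in>nr_compositions n r. vscale (of_nat (nu M a)) (gamma n r a)) =
        (\<Sum>a\<in>nr_compositions n r. vscale (of_nat (nu M' a)) (gamma n r a :: nat list \<Rightarrow>\<^sub>0 'k))"
      by (intro sum.cong) auto
    moreover have "(G_invariant M' :: nat list \<Rightarrow>\<^sub>0 'k) =
        (\<Sum>a\<in>nr_compositions n r. vscale (of_nat (nu M' a)) (gamma n r a))"
      using matroid.G_invariant_eq_sum_gamma[of M'] M' by simp
    ultimately show "(G_invariant M :: nat list \<Rightarrow>\<^sub>0 'k) = G_invariant M'"
      using formula by simp
  qed
qed

end
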